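(* For all integers $p$, $q$, $r$, $s$ and $t$, the following identities hold: \[F_{p+q-r}F_{t-s+r}+F_{p+q-r-1}F_{t-s+r-1}=F_{p-s}F_{t+q}+F_{p-s-1}F_{t+q-1},\] \[F_{p+q-r}L_{t-s+r}+F_{p+q-r-1}L_{t-s+r-1}=F_{p-s}L_{t+q}+F_{p-s-1}L_{t+q-1},\] \[L_{p+q-r}F_{t-s+r}+L_{p+q-r-1}F_{t-s+r-1}=L_{p-s}F_{t+q}+L_{p-s-1}F_{t+q-1},\] \[L_{p+q-r}L_{t-s+r}+L_{p+q-r-1}L_{t-s+r-1}=L_{p-s}L_{t+q}+L_{p-s-1}L_{t+q-1}.\]
   Context: The Fibonacci numbers $F_n$ and Lucas numbers $L_n$ are defined for all integers $n$ by $F_0=0$, $F_1=1$, $F_n=F_{n-1}+F_{n-2}$ for $n\ge 2$; $L_0=2$, $L_1=1$, $L_n=L_{n-1}+L_{n-2}$ for $n\ge 2$; and $F_{-n}=(-1)^{n-1}F_n$, $L_{-n}=(-1)^nL_n$. *)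

theory Defs
  imports Main "HOL-Number_Theory.Fib"
begin

fun lucas :: "nat \<Rightarrow> nat" where
  "lucas 0 = 2"
| "lucas (Suc 0) = 1"
| "lucas (Suc (Suc n)) = lucas (Suc n) + lucas n"

text \<open>
  Extensions to all integer indices by \<open>F (- n) = (- 1) ^ (n - 1) * F n\<close> and
  \<open>L (- n) = (- 1) ^ n * L n\<close> for positive \<open>n\<close>; the exponents are natural
  numbers, and the subtraction in \<open>nat (- n - 1)\<close> does not truncate for negative \<open>n\<close>.
\<close>

definition fib_int :: "int \<Rightarrow> int" where
  "fib_int n = (if n \<ge> 0 then int (fib (nat n))
                else (- 1) ^ nat (- n - 1) * int (fib (nat (- n))))"

definition lucas_int :: "int \<Rightarrow> int" where
  "lucas_int n = (if n \<ge> 0 then int (lucas (nat n))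
                  else (- 1) ^ nat (- n) * int (lucas (nat (- n))))"

lemma fib_int_initial: "fib_int 0 = 0" "fib_int 1 = 1"
  by (simp_all add: fib_int_def)

lemma lucas_int_initial: "lucas_int 0 = 2" "lucas_int 1 = 1"
  by (simp_all add: lucas_int_def)

lemma fib_int_rec:
  assumes "n \<ge> 2"
  shows "fib_int n = fib_int (n - 1) + fib_int (n - 2)"
proof -
  obtain k where "n = int k + 2"
    using assms by (metis add.commute zle_iff_zadd)
  then show ?thesis
    by (simp add: fib_int_def nat_add_distrib numeral_2_eq_2)
qed

lemma lucas_int_rec:
  assumes "n \<ge> 2"
  shows "lucas_int n = lucas_int (n - 1) + lucas_int (n - 2)"
proof -
  obtain k where "n = int k + 2"
    using assms by (metis add.commute zle_iff_zadd)
  then show ?thesis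
    by (simp add: lucas_int_def nat_add_distrib numeral_2_eq_2)
qed

lemma fib_int_neg: "n > 0 \<Longrightarrow> fib_int (- n) = (- 1) ^ nat (n - 1) * fib_int n"
  by (simp add: fib_int_def)

lemma lucas_int_neg: "n \<ge> 0 \<Longrightarrow> lucas_int (- n) = (- 1) ^ nat n * lucas_int n"
  by (auto simp: lucas_int_def)

end

theory Submission
  imports Defs
begin

text \<open>
  In each identity both sides have the form \<open>G a * H b + G (a - 1) * H (b - 1)\<close>, where \<open>G\<close> and
  \<open>H\<close> satisfy the Fibonacci recurrence at every integer, and the index sum \<open>a + b\<close> equals
  \<open>p + q + t - s\<close> on both sides. By the recurrence, this expression does not change when \<open>(a, b)\<close>
  is replaced by \<open>(a + 1, b - 1)\<close>, so it depends on \<open>a + b\<close> only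
  (\<open>fibonacci_recurrence_sum_invariant\<close>). It remains to extend the recurrences of
  \<open>fib_int\<close> and \<open>lucas_int\<close> to indices below 2.
\<close>

text \<open>
  The exponent \<open>Suc k\<close> has the parity of \<open>k - 1\<close> for positive \<open>k\<close>, and unlike the latter it
  needs no truncated subtraction; for \<open>k = 0\<close> both sides vanish.
\<close>

lemma fib_int_minus_of_nat: "fib_int (- int k) = (- 1) ^ Suc k * int (fib k)"
proof (cases k)
  case (Suc m)
  then have "nat (int k - 1) = m" by simp
  with Suc show ?thesis
    using fib_int_neg[of "int k"] by (simp add: fib_int_def del: of_nat_Suc)
qed (simp add: fib_int_def)

lemma lucas_int_minus_of_nat: "lucas_int (- int k) = (- 1) ^ k * int (lucas k)"
  using lucas_int_neg[of "int k"] by (simp add: lucas_int_def)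

lemma fib_int_rec_all: "fib_int n = fib_int (n - 1) + fib_int (n - 2)"
proof -
  consider "n \<ge> 2" | "n = 1" | k where "n = - int k"
    by (metis int_one_le_iff_zero_less linorder_not_le nonpos_int_cases order_le_less zle_add1_eq_le one_add_one)
  then show ?thesis
  proof cases
    case 1
    then show ?thesis by (rule fib_int_rec)
  next
    case 2
    then show ?thesis by (simp add: fib_int_def)
  next
    case 3
    then have "n - 1 = - int (Suc k)" "n - 2 = - int (Suc (Suc k))" by simp_all
    with 3 show ?thesis
      by (simp only: fib_int_minus_of_nat) (simp add: algebra_simps)
  qed
qed

lemma lucas_int_rec_all: "lucas_int n = lucas_int (n - 1) + lucas_int (n - 2)"
proof -
  consider "n \<ge> 2" | "n = 1" | k where "n = - int k"
    by (metis int_one_le_iff_zero_less linorder_not_le nonpos_int_cases order_le_less zle_add1_eq_le one_add_one)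
  then show ?thesis
  proof cases
    case 1
    then show ?thesis by (rule lucas_int_rec)
  next
    case 2
    then show ?thesis by (simp add: lucas_int_def)
  next
    case 3
    then have "n - 1 = - int (Suc k)" "n - 2 = - int (Suc (Suc k))" by simp_all
    with 3 show ?thesis
      by (simp only: lucas_int_minus_of_nat) (simp add: algebra_simps)
  qed
qed

lemma fibonacci_recurrence_sum_invariant:
  fixes G H :: "int \<Rightarrow> 'a::comm_ring_1"
  assumes G: "\<And>n. G n = G (n - 1) + G (n - 2)"
    and H: "\<And>n. H n = H (n - 1) + H (n - 2)"
    and sum: "a + b = c + d"
  shows "G a * H b + G (a - 1) * H (b - 1) = G c * H d + G (c - 1) * H (d - 1)"
proof -
  define S where "S x = G x * H (a + b - x) + G (x - 1) * H (a + b - x - 1)" for x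
  have step: "S (x + 1) = S x" for x
  proof -
    have "G (x + 1) = G x + G (x - 1)"
      using G[of "x + 1"] by simp
    moreover have "H (a + b - x) = H (a + b - x - 1) + H (a + b - x - 2)"
      by (rule H)
    ultimately show ?thesis
      by (simp add: S_def diff_diff_eq algebra_simps)
  qed
  have const: "S x = S 0" for x
  proof (induction x rule: int_induct[where k = 0])
    case (step2 i)
    then show ?case using step[of "i - 1"] by simp
  qed (simp_all add: step)
  have "S a = S c"
    using const[of a] const[of c] by simp
  moreover have "a + b - a = b" "a + b - c = d"
    using sum by simp_all
  ultimately show ?thesis
    by (simp only: S_def)
qed

theorem theorem2:
  fixes p q r s t :: int
  shows
    "fib_int (p + q - r) * fib_int (t - s + r)
       + fib_int (p + q - r - 1) * fib_int (t - s + r - 1)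
     = fib_int (p - s) * fib_int (t + q)
       + fib_int (p - s - 1) * fib_int (t + q - 1)
     \<and>
     fib_int (p + q - r) * lucas_int (t - s + r)
       + fib_int (p + q - r - 1) * lucas_int (t - s + r - 1)
     = fib_int (p - s) * lucas_int (t + q)
       + fib_int (p - s - 1) * lucas_int (t + q - 1)
     \<and>
     lucas_int (p + q - r) * fib_int (t - s + r)
       + lucas_int (p + q - r - 1) * fib_int (t - s + r - 1)
     = lucas_int (p - s) * fib_int (t + q)
       + lucas_int (p - s - 1) * fib_int (t + q - 1)
     \<and>
     lucas_int (p + q - r) * lucas_int (t - s + r)
       + lucas_int (p + q - r - 1) * lucas_int (t - s + r - 1)
     = lucas_int (p - s) * lucas_int (t + q)
       + lucas_int (p - s - 1) * lucas_int (t + q - 1)"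
  by (intro conjI fibonacci_recurrence_sum_invariant fib_int_rec_all lucas_int_rec_all) simp_all

end
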